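(* Let $\gamma,L>0$ and $\varepsilon\ge 0$ with $\frac{\varepsilon L}{\gamma}<1$. Suppose that: for every $w\in M$, $\phi(\cdot,\cdot,w)$ is continuously differentiable on $\mathbb{R}^n\times\mathbb{R}^m$, $\gamma$-strongly convex in $x$ for every $y\in\mathbb{R}^m$ and $\gamma$-strongly concave in $y$ for every $x\in\mathbb{R}^n$; the map $\psi(z,w)=(\nabla_x\phi(z,w),-\nabla_y\phi(z,w))$ satisfies $\|\psi(z,w)-\psi(z',w)\|\le L\|z-z'\|$ and $\|\psi(z,w)-\psi(z,w')\|\le L\,\mathrm{d}(w,w')$ for all $z,z'\in\mathbb{R}^n\times\mathbb{R}^m$ and $w,w'\in M$; $W_1(D(z),D(z'))\le\varepsilon\|z-z'\|$ for all $z,z'\in\mathbb{R}^n\times\mathbb{R}^m$; and $\mathcal{X}\subset\mathbb{R}^n$, $\mathcal{Y}\subset\mathbb{R}^m$ are compact and convex. Let $\eta>0$ and let $\bar z$ be the unique equilibrium point. Then for any initial point $z_0\in\mathcal{Z}$, the sequence $z_{t+1}=\Pi_{\mathcal{Z}}(z_t-\eta\Psi(z_t;z_t))$, $t\ge0$, satisfies $$\|z_t-\bar z\|\le\alpha^t\|z_0-\bar z\|,\qquad \alpha:=\sqrt{1-2\eta\gamma+\eta^2L^2}+\eta\varepsilon L .$$ Furthermore, if $\eta\in\left(0,\frac{2(\gamma-\varepsilon L)}{L^2(1-\varepsilon^2)}\right)$, then $z_t$ converges linearly to the unique equilibrium point $\bar z$.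
   Context: $(M,\mathrm{d})$ is a complete separable metric space, $\mathcal{P}(M)$ is the set of Radon probability measures on $M$ with finite first moment, and $W_1$ is the Wasserstein-1 distance. $\phi:\mathbb{R}^n\times\mathbb{R}^m\times M\to\mathbb{R}$, and $D:\mathbb{R}^n\times\mathbb{R}^m\to\mathcal{P}(M)$ is the distributional map. Write $z=(x,y)$, $\mathcal{Z}=\mathcal{X}\times\mathcal{Y}$ (nonempty), and $\Psi(z;z')=\mathbb{E}_{w\sim D(z')}[\psi(z,w)]$. $\Pi_{\mathcal{Z}}$ is the Euclidean projection onto $\mathcal{Z}$. An equilibrium point is a pair $(\bar x,\bar y)\in\mathcal{Z}$ with $\bar x\in\arg\min_{x\in\mathcal{X}}\max_{y\in\mathcal{Y}}\mathbb{E}_{w\sim D(\bar x,\bar y)}[\phi(x,y,w)]$ and $\bar y\in\arg\max_{y\in\mathcal{Y}}\min_{x\in\mathcal{X}}\mathbb{E}_{w\sim D(\bar x,\bar y)}[\phi(x,y,w)]$; under the hypotheses it exists and is unique. Expectations are assumed well defined. *)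

theory Defs
  imports "HOL-Probability.Probability"
begin

text \<open>
  The metric space \<open>M\<close> is a type of class \<^class>\<open>polish_space\<close>, i.e. a complete separable
  metric space. Points \<open>z = (x, y)\<close> have type \<open>real ^ 'n \<times> real ^ 'm\<close>, whose norm is
  Euclidean: \<open>norm (x, y) = sqrt ((norm x)\<^sup>2 + (norm y)\<^sup>2)\<close>.
\<close>

text \<open>For finite measures, being Radon amounts to inner regularity with respect to compact sets.\<close>

definition radon_prob :: "'w::metric_space measure \<Rightarrow> bool" where
  "radon_prob \<mu> \<longleftrightarrow> prob_space \<mu> \<and> sets \<mu> = sets borel \<and>
     (\<forall>B\<in>sets borel. emeasure \<mu> B = (SUP K\<in>{K. K \<subseteq> B \<and> compact K}. emeasure \<mu> K))"

definition finite_first_moment :: "'w::metric_space measure \<Rightarrow> bool" where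
  "finite_first_moment \<mu> \<longleftrightarrow> (\<exists>w0. (\<integral>\<^sup>+ w. ennreal (dist w0 w) \<partial>\<mu>) < \<infinity>)"

definition radon_prob_moment1 :: "'w::metric_space measure set" where
  "radon_prob_moment1 = {\<mu>. radon_prob \<mu> \<and> finite_first_moment \<mu>}"

definition couplings ::
  "'w::polish_space measure \<Rightarrow> 'w measure \<Rightarrow> ('w \<times> 'w) measure set" where
  "couplings \<mu> \<nu> = {\<pi>. prob_space \<pi> \<and> sets \<pi> = sets borel \<and>
     distr \<pi> borel fst = \<mu> \<and> distr \<pi> borel snd = \<nu>}"

definition wasserstein1 :: "'w::polish_space measure \<Rightarrow> 'w measure \<Rightarrow> ennreal" where
  "wasserstein1 \<mu> \<nu> =
     (INF \<pi>\<in>couplings \<mu> \<nu>. \<integral>\<^sup>+ p. ennreal (dist (fst p) (snd p)) \<partial>\<pi>)"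

definition continuously_differentiable ::
  "('a::real_normed_vector \<Rightarrow> 'b::real_normed_vector) \<Rightarrow> bool" where
  "continuously_differentiable f \<longleftrightarrow>
     (\<exists>f'. (\<forall>x. (f has_derivative blinfun_apply (f' x)) (at x)) \<and> continuous_on UNIV f')"

definition gradient :: "('a::real_inner \<Rightarrow> real) \<Rightarrow> 'a \<Rightarrow> 'a" where
  "gradient f x = (THE g. GDERIV f x :> g)"

definition strongly_convex :: "real \<Rightarrow> ('a::real_normed_vector \<Rightarrow> real) \<Rightarrow> bool" where
  "strongly_convex \<gamma> f \<longleftrightarrow>
     (\<forall>u v t. 0 \<le> t \<and> t \<le> 1 \<longrightarrow>
        f ((1 - t) *\<^sub>R u + t *\<^sub>R v)
          \<le> (1 - t) * f u + t * f v - \<gamma> / 2 * t * (1 - t) * (norm (u - v))\<^sup>2)"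

definition strongly_concave :: "real \<Rightarrow> ('a::real_normed_vector \<Rightarrow> real) \<Rightarrow> bool" where
  "strongly_concave \<gamma> f \<longleftrightarrow> strongly_convex \<gamma> (\<lambda>u. - f u)"

text \<open>\<open>saddle_map \<phi>\<close> is \<open>\<psi>\<close>, and \<open>mean_saddle_map \<phi> D z z'\<close> is \<open>\<Psi>(z; z')\<close>.\<close>

definition saddle_map ::
  "('a::real_inner \<times> 'b::real_inner \<Rightarrow> 'w \<Rightarrow> real) \<Rightarrow> 'a \<times> 'b \<Rightarrow> 'w \<Rightarrow> 'a \<times> 'b" where
  "saddle_map \<phi> z w =
     (gradient (\<lambda>x. \<phi> (x, snd z) w) (fst z), - gradient (\<lambda>y. \<phi> (fst z, y) w) (snd z))"

definition mean_saddle_map ::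
  "('a::euclidean_space \<times> 'b::euclidean_space \<Rightarrow> 'w \<Rightarrow> real) \<Rightarrow> ('a \<times> 'b \<Rightarrow> 'w measure) \<Rightarrow>
     'a \<times> 'b \<Rightarrow> 'a \<times> 'b \<Rightarrow> 'a \<times> 'b" where
  "mean_saddle_map \<phi> D z z' = (LINT w|D z'. saddle_map \<phi> z w)"

text \<open>
  The inner maximum and minimum are taken as supremum and infimum in \<^typ>\<open>ereal\<close>, so that they
  make sense without presupposing attainment or boundedness.
\<close>

definition equilibrium_point ::
  "('a \<times> 'b \<Rightarrow> 'w \<Rightarrow> real) \<Rightarrow> ('a \<times> 'b \<Rightarrow> 'w measure) \<Rightarrow> 'a set \<Rightarrow> 'b set \<Rightarrow> 'a \<times> 'b \<Rightarrow> bool" where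
  "equilibrium_point \<phi> D X Y zbar \<longleftrightarrow>
     is_arg_min (\<lambda>x. SUP y\<in>Y. ereal (LINT w|D zbar. \<phi> (x, y) w)) (\<lambda>x. x \<in> X) (fst zbar) \<and>
     is_arg_max (\<lambda>y. INF x\<in>X. ereal (LINT w|D zbar. \<phi> (x, y) w)) (\<lambda>y. y \<in> Y) (snd zbar)"

definition projected_gradient_seq ::
  "('a::euclidean_space \<times> 'b::euclidean_space \<Rightarrow> 'w \<Rightarrow> real) \<Rightarrow> ('a \<times> 'b \<Rightarrow> 'w measure) \<Rightarrow>
     'a set \<Rightarrow> 'b set \<Rightarrow> real \<Rightarrow> (nat \<Rightarrow> 'a \<times> 'b) \<Rightarrow> bool" where
  "projected_gradient_seq \<phi> D X Y \<eta> z \<longleftrightarrow>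
     z 0 \<in> X \<times> Y \<and>
     (\<forall>t. z (Suc t) = closest_point (X \<times> Y) (z t - \<eta> *\<^sub>R mean_saddle_map \<phi> D (z t) (z t)))"

definition converges_linearly :: "(nat \<Rightarrow> 'a::metric_space) \<Rightarrow> 'a \<Rightarrow> bool" where
  "converges_linearly s l \<longleftrightarrow>
     s \<longlonglongrightarrow> l \<and> (\<exists>\<rho>. 0 \<le> \<rho> \<and> \<rho> < 1 \<and> (\<forall>t. dist (s (Suc t)) l \<le> \<rho> * dist (s t) l))"

end

theory Submission
  imports Defs
begin

text \<open>
  The mean saddle map \<open>\<Psi>(z; z')\<close> is \<open>\<gamma>\<close>-strongly monotone and \<open>L\<close>-Lipschitz in \<open>z\<close>, because the
  integrand \<open>\<psi>(\<sqdot>, w)\<close> is, and it is \<open>\<epsilon> L\<close>-Lipschitz in \<open>z'\<close>: integrating an \<open>L\<close>-Lipschitz function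
  against a coupling of \<open>D(z')\<close> and \<open>D(z'')\<close> bounds the difference of its means by \<open>L\<close> times the
  Wasserstein distance (\<open>norm_integral_diff_le_wasserstein1\<close>). Hence one projected step
  \<open>z \<mapsto> \<Pi>(z - \<eta> \<Psi>(z; z))\<close> is \<open>\<alpha>\<close>-Lipschitz (\<open>projected_step_Lipschitz\<close>): the factor
  \<open>sqrt (1 - 2 \<eta> \<gamma> + \<eta>\<^sup>2 L\<^sup>2)\<close> is the cost of moving the first argument of \<open>\<Psi>\<close>, and \<open>\<eta> \<epsilon> L\<close> that of moving
  the distribution. For \<open>\<eta>\<close> in the stated interval \<open>\<alpha> < 1\<close>, using that
  \<open>\<gamma> \<le> L\<close> by monotonicity and the Lipschitz bound.

  A point \<open>z\<close> of a closed convex set is fixed by the projected step, for one or equivalently every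
  positive step size, exactly when it solves the variational inequality \<open>\<Psi>(z; z) \<bullet> (s - z) \<ge> 0\<close> for all
  admissible \<open>s\<close>. So Banach's fixed point theorem, applied with some small step size, yields a
  unique solution (\<open>ex1_variational_solution\<close>), and every solution is fixed by the step of the given
  size, which gives the rate.

  It remains to identify solutions with equilibria (\<open>equilibrium_point_iff_variational_solution\<close>).
  The link between the objective and \<open>\<Psi>\<close> is \<open>gap_inequality\<close>, which combines strong convexity and
  strong concavity. It holds for each \<open>w\<close> and is linear in \<open>\<phi>\<close> and \<open>\<psi>\<close>, so it can be integrated
  over \<open>w\<close> and relates the mean payoff directly to the mean of the gradients.
  For a distribution \<open>D(z')\<close> held fixed it shows that a solution \<open>(x\<^sup>*, y\<^sup>*)\<close> of the variational inequality for \<open>\<Psi>(\<sqdot>; z')\<close> is a strict saddle point with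
  quadratic growth; then \<open>x\<^sup>*\<close> is the only minimiser of the inner supremum and \<open>y\<^sup>*\<close> the only
  maximiser of the inner infimum. Such a solution exists, by the same fixed point argument with a
  constant distributional map. Taking \<open>z'\<close> to be a feasible candidate itself, the candidate is an
  equilibrium iff it coincides with that solution.
\<close>

section \<open>Variational inequalities and the projected step\<close>

definition variational_solution :: "'a::real_inner set \<Rightarrow> ('a \<Rightarrow> 'a) \<Rightarrow> 'a \<Rightarrow> bool" where
  "variational_solution S G z \<longleftrightarrow> z \<in> S \<and> (\<forall>s\<in>S. 0 \<le> G z \<bullet> (s - z))"

definition projected_step :: "'a::euclidean_space set \<Rightarrow> real \<Rightarrow> ('a \<Rightarrow> 'a) \<Rightarrow> 'a \<Rightarrow> 'a" where
  "projected_step S \<eta> G z = closest_point S (z - \<eta> *\<^sub>R G z)"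

text \<open>
  The projection \<open>p\<close> of \<open>a\<close> onto \<open>S\<close> is characterised by \<open>(a - p) \<bullet> (s - p) \<le> 0\<close> for \<open>s \<in> S\<close>. At
  \<open>a = z - \<eta> G z\<close> and \<open>p = z\<close> this is the variational inequality scaled by \<open>- \<eta>\<close>.
\<close>

lemma projected_step_fixed_iff:
  assumes "closed S" "convex S" "S \<noteq> {}" "\<eta> > 0"
  shows "projected_step S \<eta> G z = z \<longleftrightarrow> variational_solution S G z"
proof
  assume fixed: "projected_step S \<eta> G z = z"
  have "z \<in> S"
    using closest_point_in_set[OF assms(1,3)] fixed unfolding projected_step_def by metis
  moreover have "0 \<le> G z \<bullet> (s - z)" if "s \<in> S" for s
    using closest_point_dot[OF assms(2,1) that, of "z - \<eta> *\<^sub>R G z"] fixed \<open>\<eta> > 0\<close>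
    by (simp add: projected_step_def zero_le_mult_iff)
  ultimately show "variational_solution S G z"
    by (simp add: variational_solution_def)
next
  assume vs: "variational_solution S G z"
  have "dist (z - \<eta> *\<^sub>R G z) z \<le> dist (z - \<eta> *\<^sub>R G z) s" if "s \<in> S" for s
  proof -
    have "0 \<le> \<eta> * (G z \<bullet> (s - z))"
      using vs that \<open>\<eta> > 0\<close> by (simp add: variational_solution_def)
    then have "(norm (\<eta> *\<^sub>R G z))\<^sup>2 \<le> (norm (\<eta> *\<^sub>R G z + (s - z)))\<^sup>2"
      unfolding power2_norm_eq_inner by (simp add: inner_add inner_commute)
    then have "norm (\<eta> *\<^sub>R G z) \<le> norm (\<eta> *\<^sub>R G z + (s - z))"
      by (rule power2_le_imp_le) simp
    also have "\<eta> *\<^sub>R G z + (s - z) = - (z - \<eta> *\<^sub>R G z - s)"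
      by simp
    finally show ?thesis
      by (simp add: dist_norm norm_minus_cancel del: minus_diff_eq)
  qed
  then show "projected_step S \<eta> G z = z"
    using closest_point_unique[OF assms(2,1)] vs
    by (metis projected_step_def variational_solution_def)
qed

text \<open>
  Passing through the intermediate value \<open>G z' z\<close> separates the two ways in which \<open>G\<close> depends on the
  point. For the change in the first argument, expanding the square of the distance after the step
  brings in its inner product with \<open>z - z'\<close>, which monotonicity bounds from below; of the change in
  the second argument only the size is known, and the triangle inequality adds it.
  The projection itself is nonexpansive.
\<close>

lemma projected_step_Lipschitz:
  fixes S :: "'a::euclidean_space set" and G :: "'a \<Rightarrow> 'a \<Rightarrow> 'a"
  assumes S: "closed S" "convex S" "S \<noteq> {}"
    and monotone: "\<gamma> * (norm (z - z'))\<^sup>2 \<le> (G z z - G z' z) \<bullet> (z - z')"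
    and Lipschitz: "norm (G z z - G z' z) \<le> L * norm (z - z')"
    and Lipschitz_snd: "norm (G z' z - G z' z') \<le> \<delta> * norm (z - z')"
    and "\<eta> > 0"
  shows "dist (projected_step S \<eta> (\<lambda>u. G u u) z) (projected_step S \<eta> (\<lambda>u. G u u) z')
    \<le> (sqrt (1 - 2 * \<eta> * \<gamma> + \<eta>\<^sup>2 * L\<^sup>2) + \<eta> * \<delta>) * dist z z'"
proof -
  let ?d = "z - z'" and ?e = "G z z - G z' z"
  have "(norm ?e)\<^sup>2 \<le> (L * norm ?d)\<^sup>2"
    using Lipschitz by (rule power_mono) simp
  then have sq: "\<eta>\<^sup>2 * (norm ?e)\<^sup>2 \<le> \<eta>\<^sup>2 * L\<^sup>2 * (norm ?d)\<^sup>2"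
    by (simp add: power_mult_distrib mult.assoc mult_left_mono)
  have "(norm (?d - \<eta> *\<^sub>R ?e))\<^sup>2 = (norm ?d)\<^sup>2 - 2 * \<eta> * (?e \<bullet> ?d) + \<eta>\<^sup>2 * (norm ?e)\<^sup>2"
    unfolding power2_norm_eq_inner
    by (simp only: inner_diff_left inner_diff_right inner_scaleR_left inner_scaleR_right
        inner_commute) (simp add: algebra_simps power2_eq_square inner_commute)
  also have "\<dots> \<le> (norm ?d)\<^sup>2 - 2 * \<eta> * (\<gamma> * (norm ?d)\<^sup>2) + \<eta>\<^sup>2 * L\<^sup>2 * (norm ?d)\<^sup>2"
    using mult_left_mono[OF monotone, of "2 * \<eta>"] \<open>\<eta> > 0\<close> sq by linarith
  also have "\<dots> = (1 - 2 * \<eta> * \<gamma> + \<eta>\<^sup>2 * L\<^sup>2) * (norm ?d)\<^sup>2"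
    by (simp add: algebra_simps)
  finally have "norm (?d - \<eta> *\<^sub>R ?e) \<le> sqrt ((1 - 2 * \<eta> * \<gamma> + \<eta>\<^sup>2 * L\<^sup>2) * (norm ?d)\<^sup>2)"
    by (rule real_le_rsqrt)
  then have forward: "norm (?d - \<eta> *\<^sub>R ?e) \<le> sqrt (1 - 2 * \<eta> * \<gamma> + \<eta>\<^sup>2 * L\<^sup>2) * norm ?d"
    by (simp add: real_sqrt_mult)
  have "dist (projected_step S \<eta> (\<lambda>u. G u u) z) (projected_step S \<eta> (\<lambda>u. G u u) z')
      \<le> norm ((z - \<eta> *\<^sub>R G z z) - (z' - \<eta> *\<^sub>R G z' z'))"
    unfolding projected_step_def using closest_point_lipschitz[OF S(2,1,3)] by (metis dist_norm)
  also have "(z - \<eta> *\<^sub>R G z z) - (z' - \<eta> *\<^sub>R G z' z') = (?d - \<eta> *\<^sub>R ?e) - \<eta> *\<^sub>R (G z' z - G z' z')"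
    by (simp add: algebra_simps)
  also have "norm \<dots> \<le> norm (?d - \<eta> *\<^sub>R ?e) + norm (\<eta> *\<^sub>R (G z' z - G z' z'))"
    by (rule norm_triangle_ineq4)
  also have "norm (\<eta> *\<^sub>R (G z' z - G z' z')) \<le> \<eta> * (\<delta> * norm ?d)"
    using Lipschitz_snd \<open>\<eta> > 0\<close> by simp
  finally show ?thesis
    using forward by (simp add: dist_norm algebra_simps)
qed

text \<open>
  After isolating the root and squaring, \<open>\<alpha> < 1\<close> becomes the bound on \<open>\<eta>\<close>. Squaring requires
  \<open>\<eta> \<epsilon> L < 1\<close>, which the bound on \<open>\<eta>\<close> also implies: since \<open>\<gamma> \<le> L\<close>, it gives
  \<open>\<eta> L (1 + \<epsilon>) < 2\<close>, and \<open>2 \<epsilon> \<le> 1 + \<epsilon>\<close>.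
\<close>

lemma contraction_factor_less_1:
  fixes \<gamma> L \<epsilon> \<eta> :: real
  assumes "\<gamma> \<le> L" "L > 0" "\<epsilon> \<ge> 0" "\<epsilon> * L < \<gamma>"
    and eta: "0 < \<eta>" "\<eta> < 2 * (\<gamma> - \<epsilon> * L) / (L\<^sup>2 * (1 - \<epsilon>\<^sup>2))"
  shows "sqrt (1 - 2 * \<eta> * \<gamma> + \<eta>\<^sup>2 * L\<^sup>2) + \<eta> * \<epsilon> * L < 1"
proof -
  have "\<epsilon> * L < 1 * L"
    using assms(1,4) by linarith
  then have "\<epsilon> < 1"
    using \<open>L > 0\<close> by (simp only: mult_less_cancel_right_pos)
  then have eps2: "0 < 1 - \<epsilon>\<^sup>2"
    using \<open>\<epsilon> \<ge> 0\<close> by (simp add: power_less_one_iff abs_square_less_1)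
  then have bound: "\<eta> * (L\<^sup>2 * (1 - \<epsilon>\<^sup>2)) < 2 * (\<gamma> - \<epsilon> * L)"
    using eta \<open>L > 0\<close> by (simp add: pos_less_divide_eq)
  have "(\<eta> * L * (1 + \<epsilon>)) * (L * (1 - \<epsilon>)) = \<eta> * (L\<^sup>2 * (1 - \<epsilon>\<^sup>2))"
    by (simp add: algebra_simps power2_eq_square)
  also have "\<dots> < 2 * (L * (1 - \<epsilon>))"
    using bound \<open>\<gamma> \<le> L\<close> by (simp add: algebra_simps)
  finally have "\<eta> * L * (1 + \<epsilon>) < 2"
    using \<open>\<epsilon> < 1\<close> \<open>L > 0\<close> by (simp add: mult_less_cancel_right)
  moreover have "\<eta> * L * (2 * \<epsilon>) \<le> \<eta> * L * (1 + \<epsilon>)"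
    using \<open>\<epsilon> < 1\<close> \<open>L > 0\<close> \<open>0 < \<eta>\<close> by simp
  ultimately have small: "\<eta> * \<epsilon> * L < 1"
    by (simp add: algebra_simps)
  have "\<eta> * (\<eta> * (L\<^sup>2 * (1 - \<epsilon>\<^sup>2))) < \<eta> * (2 * (\<gamma> - \<epsilon> * L))"
    using bound \<open>0 < \<eta>\<close> by simp
  then have "1 - 2 * \<eta> * \<gamma> + \<eta>\<^sup>2 * L\<^sup>2 < (1 - \<eta> * \<epsilon> * L)\<^sup>2"
    by (simp add: algebra_simps power2_eq_square)
  then have "sqrt (1 - 2 * \<eta> * \<gamma> + \<eta>\<^sup>2 * L\<^sup>2) < 1 - \<eta> * \<epsilon> * L"
    using small by (intro real_less_lsqrt) auto
  then show ?thesis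
    by simp
qed

lemma contraction_factor_nonneg:
  fixes \<gamma> L \<epsilon> \<eta> :: real
  assumes "0 \<le> \<gamma>" "\<gamma> \<le> L" "\<epsilon> \<ge> 0" "\<eta> \<ge> 0"
  shows "0 \<le> sqrt (1 - 2 * \<eta> * \<gamma> + \<eta>\<^sup>2 * L\<^sup>2) + \<eta> * \<epsilon> * L"
proof -
  have "\<eta>\<^sup>2 * \<gamma>\<^sup>2 \<le> \<eta>\<^sup>2 * L\<^sup>2"
    using assms by (intro mult_left_mono power_mono) auto
  then have "(1 - \<eta> * \<gamma>)\<^sup>2 \<le> 1 - 2 * \<eta> * \<gamma> + \<eta>\<^sup>2 * L\<^sup>2"
    by (simp add: power2_eq_square algebra_simps)
  then have "0 \<le> 1 - 2 * \<eta> * \<gamma> + \<eta>\<^sup>2 * L\<^sup>2"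
    using zero_le_power2 order_trans by blast
  with assms show ?thesis
    by simp
qed

lemma ex1_variational_solution:
  fixes S :: "'a::euclidean_space set" and G :: "'a \<Rightarrow> 'a \<Rightarrow> 'a"
  assumes S: "closed S" "convex S" "S \<noteq> {}"
    and monotone: "\<And>z z' u. \<gamma> * (norm (z - z'))\<^sup>2 \<le> (G z u - G z' u) \<bullet> (z - z')"
    and Lipschitz: "\<And>z z' u. norm (G z u - G z' u) \<le> L * norm (z - z')"
    and Lipschitz_snd: "\<And>z u u'. norm (G z u - G z u') \<le> \<epsilon> * L * norm (u - u')"
    and const: "0 \<le> \<gamma>" "\<gamma> \<le> L" "L > 0" "\<epsilon> \<ge> 0" "\<epsilon> * L < \<gamma>"
  shows "\<exists>!z. variational_solution S (\<lambda>u. G u u) z"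
proof -
  \<comment> \<open>Any step size in the contraction interval would do; this is its midpoint.\<close>
  define \<eta> where "\<eta> = (\<gamma> - \<epsilon> * L) / (L\<^sup>2 * (1 - \<epsilon>\<^sup>2))"
  have "\<epsilon> * L < 1 * L"
    using const by linarith
  then have "\<epsilon> < 1"
    using \<open>L > 0\<close> by (simp only: mult_less_cancel_right_pos)
  then have "0 < 1 - \<epsilon>\<^sup>2"
    using \<open>\<epsilon> \<ge> 0\<close> by (simp add: power_less_one_iff abs_square_less_1)
  then have "\<eta> > 0"
    using const by (simp add: \<eta>_def)
  moreover have "2 * (\<gamma> - \<epsilon> * L) / (L\<^sup>2 * (1 - \<epsilon>\<^sup>2)) = 2 * \<eta>"
    by (simp add: \<eta>_def)
  ultimately have eta: "0 < \<eta>" "\<eta> < 2 * (\<gamma> - \<epsilon> * L) / (L\<^sup>2 * (1 - \<epsilon>\<^sup>2))"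
    by auto
  have "\<exists>!z\<in>S. projected_step S \<eta> (\<lambda>u. G u u) z = z"
  proof (rule Banach_fix[OF complete_eq_closed[THEN iffD2, OF S(1)] S(3)])
    show "0 \<le> sqrt (1 - 2 * \<eta> * \<gamma> + \<eta>\<^sup>2 * L\<^sup>2) + \<eta> * \<epsilon> * L"
      using const eta by (intro contraction_factor_nonneg) auto
    show "sqrt (1 - 2 * \<eta> * \<gamma> + \<eta>\<^sup>2 * L\<^sup>2) + \<eta> * \<epsilon> * L < 1"
      using const eta by (intro contraction_factor_less_1) auto
    show "projected_step S \<eta> (\<lambda>u. G u u) ` S \<subseteq> S"
      using closest_point_in_set[OF S(1,3)] by (auto simp: projected_step_def)
    show "dist (projected_step S \<eta> (\<lambda>u. G u u) z) (projected_step S \<eta> (\<lambda>u. G u u) z')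
        \<le> (sqrt (1 - 2 * \<eta> * \<gamma> + \<eta>\<^sup>2 * L\<^sup>2) + \<eta> * \<epsilon> * L) * dist z z'" for z z'
      using projected_step_Lipschitz[OF S, of \<gamma> z z' G L "\<epsilon> * L" \<eta>]
        monotone Lipschitz Lipschitz_snd eta(1) by (simp add: mult.assoc)
  qed
  then show ?thesis
    using projected_step_fixed_iff[OF S eta(1)] by (metis variational_solution_def)
qed

section \<open>First-order inequality for strongly convex functions\<close>

lemma GDERIV_gradient:
  fixes f :: "'a::euclidean_space \<Rightarrow> real"
  assumes "f differentiable (at x)"
  shows "GDERIV f x :> gradient f x"
proof -
  obtain f' where f': "(f has_derivative f') (at x)"
    using assms by (auto simp: differentiable_def)
  \<comment> \<open>The representing vector of the functional \<open>f'\<close> is the value of its adjoint at \<open>1\<close>.\<close>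
  have "f' = (\<lambda>h. h \<bullet> adjoint f' 1)"
    using adjoint_works[OF has_derivative_linear[OF f'], of _ 1] by auto
  then have deriv: "GDERIV f x :> adjoint f' 1"
    using f' unfolding gderiv_def by metis
  have "g = adjoint f' 1" if "GDERIV f x :> g" for g
  proof (rule vector_eq_ldot[THEN iffD1, rule_format])
    show "h \<bullet> g = h \<bullet> adjoint f' 1" for h
      using has_derivative_unique[OF that[unfolded gderiv_def] deriv[unfolded gderiv_def]]
      by metis
  qed
  with deriv show ?thesis
    unfolding gradient_def by (rule theI)
qed

text \<open>
  Dividing the strong convexity inequality on the segment from \<open>u\<close> to \<open>v\<close> by the parameter \<open>t\<close> bounds
  a difference quotient whose limit for \<open>t \<rightarrow> 0\<close> is the directional derivative.
\<close>

lemma strongly_convex_gradient_le: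
  fixes f :: "'a::euclidean_space \<Rightarrow> real"
  assumes convex: "strongly_convex \<gamma> f" and diff: "f differentiable (at u)"
  shows "f u + gradient f u \<bullet> (v - u) + \<gamma> / 2 * (norm (v - u))\<^sup>2 \<le> f v"
proof -
  let ?h = "\<lambda>t. f (u + t *\<^sub>R (v - u))"
  have line: "((\<lambda>t. u + t *\<^sub>R (v - u)) has_derivative (\<lambda>t. t *\<^sub>R (v - u))) (at 0)"
    by (auto intro!: derivative_eq_intros)
  have "(f has_derivative (\<lambda>k. k \<bullet> gradient f u)) (at (u + 0 *\<^sub>R (v - u)))"
    using GDERIV_gradient[OF diff] by (simp add: gderiv_def)
  from has_derivative_compose[OF line this]
  have "(?h has_real_derivative gradient f u \<bullet> (v - u)) (at 0)"
    unfolding has_field_derivative_def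
    by (rule has_derivative_eq_rhs) (auto simp: inner_commute)
  then have lim: "((\<lambda>t. (?h t - f u) / t) \<longlongrightarrow> gradient f u \<bullet> (v - u)) (at_right 0)"
    unfolding has_field_derivative_iff by (simp add: filterlim_at_split)
  have "((\<lambda>t. f v - f u - \<gamma> / 2 * (1 - t) * (norm (v - u))\<^sup>2)
      \<longlongrightarrow> f v - f u - \<gamma> / 2 * (1 - 0) * (norm (v - u))\<^sup>2) (at_right 0)"
    by (intro tendsto_intros)
  moreover have "eventually (\<lambda>t. (?h t - f u) / t
      \<le> f v - f u - \<gamma> / 2 * (1 - t) * (norm (v - u))\<^sup>2) (at_right (0::real))"
  proof (rule eventually_at_rightI[of 0 1])
    fix t :: real
    assume t: "t \<in> {0<..<1}"
    have "(1 - t) *\<^sub>R u + t *\<^sub>R v = u + t *\<^sub>R (v - u)"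
      by (simp add: algebra_simps)
    then have "?h t - f u \<le> (f v - f u - \<gamma> / 2 * (1 - t) * (norm (v - u))\<^sup>2) * t"
      using convex[unfolded strongly_convex_def, rule_format, of t u v] t
      by (simp add: norm_minus_commute algebra_simps)
    then show "(?h t - f u) / t \<le> f v - f u - \<gamma> / 2 * (1 - t) * (norm (v - u))\<^sup>2"
      using t by (simp add: pos_divide_le_eq)
  qed simp
  ultimately have "gradient f u \<bullet> (v - u) \<le> f v - f u - \<gamma> / 2 * (1 - 0) * (norm (v - u))\<^sup>2"
    using lim by (intro tendsto_le[of "at_right 0"]) auto
  then show ?thesis
    by simp
qed

section \<open>Lipschitz functions and the Wasserstein distance\<close>

lemma integrable_Lipschitz:
  fixes f :: "'w::metric_space \<Rightarrow> 'b::{banach, second_countable_topology}"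
  assumes \<mu>: "\<mu> \<in> radon_prob_moment1"
    and Lipschitz: "\<And>w w'. norm (f w - f w') \<le> K * dist w w'"
  shows "integrable \<mu> f"
proof -
  interpret prob_space \<mu>
    using \<mu> by (simp add: radon_prob_moment1_def radon_prob_def)
  have sets: "sets \<mu> = sets borel"
    using \<mu> by (simp add: radon_prob_moment1_def radon_prob_def)
  obtain w0 where w0: "(\<integral>\<^sup>+ w. ennreal (dist w0 w) \<partial>\<mu>) < \<infinity>"
    using \<mu> by (auto simp: radon_prob_moment1_def finite_first_moment_def)
  have "dist (f w) (f w') \<le> \<bar>K\<bar> * dist w w'" for w w'
    using order_trans[OF Lipschitz mult_right_mono[of K "\<bar>K\<bar>"]] by (simp add: dist_norm)
  then have "\<bar>K\<bar>-lipschitz_on UNIV f"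
    by (intro lipschitz_onI) auto
  then have meas: "f \<in> borel_measurable \<mu>"
    using lipschitz_on_continuous_on borel_measurable_continuous_onI measurable_cong_sets[OF sets refl]
    by blast
  have "(\<lambda>w. dist w0 w) \<in> borel_measurable \<mu>"
    unfolding measurable_cong_sets[OF sets refl]
    by (intro borel_measurable_continuous_onI continuous_intros)
  then have "integrable \<mu> (\<lambda>w. dist w0 w)"
    using w0 by (intro integrableI_bounded) auto
  then have "integrable \<mu> (\<lambda>w. norm (f w0) + K * dist w0 w)"
    by simp
  then show ?thesis
  proof (rule Bochner_Integration.integrable_bound[OF _ meas], intro AE_I2)
    fix w
    have "norm (f w) \<le> norm (f w0) + norm (f w0 - f w)"
      using norm_triangle_sub[of "f w" "f w0"] by (simp add: norm_minus_commute)
    also have "\<dots> \<le> norm (f w0) + K * dist w0 w"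
      using Lipschitz by simp
    finally show "norm (f w) \<le> norm (norm (f w0) + K * dist w0 w)"
      by simp
  qed
qed

text \<open>
  The easy half of Kantorovich duality, for vector-valued functions: a coupling rewrites the
  difference of the two means as a single integral of \<open>f (fst p) - f (snd p)\<close>.
\<close>

lemma norm_integral_diff_le_wasserstein1:
  fixes f :: "'w::polish_space \<Rightarrow> 'b::{banach, second_countable_topology}"
  assumes \<mu>: "\<mu> \<in> radon_prob_moment1" and \<nu>: "\<nu> \<in> radon_prob_moment1"
    and Lipschitz: "\<And>w w'. norm (f w - f w') \<le> K * dist w w'"
    and "K > 0" "c \<ge> 0" and W: "wasserstein1 \<mu> \<nu> \<le> ennreal c"
  shows "norm (integral\<^sup>L \<mu> f - integral\<^sup>L \<nu> f) \<le> K * c"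
proof -
  let ?d = "norm (integral\<^sup>L \<mu> f - integral\<^sup>L \<nu> f)"
  have int: "integrable \<mu> f" "integrable \<nu> f"
    using integrable_Lipschitz \<mu> \<nu> Lipschitz by blast+
  have "sets \<mu> = sets borel"
    using \<mu> by (simp add: radon_prob_moment1_def radon_prob_def)
  then have f[measurable]: "f \<in> borel_measurable borel"
    using borel_measurable_integrable[OF int(1)] measurable_cong_sets by blast
  have "ennreal (?d / K) \<le> wasserstein1 \<mu> \<nu>"
    unfolding wasserstein1_def
  proof (rule INF_greatest)
    fix \<pi>
    assume "\<pi> \<in> couplings \<mu> \<nu>"
    then have sets: "sets \<pi> = sets borel"
      and marginals: "distr \<pi> borel fst = \<mu>" "distr \<pi> borel snd = \<nu>"
      by (auto simp: couplings_def)
    have proj: "fst \<in> measurable \<pi> borel" "snd \<in> measurable \<pi> borel"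
      unfolding measurable_cong_sets[OF sets refl]
      by (auto intro!: borel_measurable_continuous_onI continuous_intros)
    have int\<pi>: "integrable \<pi> (\<lambda>p. f (fst p))" "integrable \<pi> (\<lambda>p. f (snd p))"
      using int integrable_distr_eq[OF proj(1) f] integrable_distr_eq[OF proj(2) f]
      by (simp_all add: marginals)
    have "(\<integral>p. f (fst p) - f (snd p) \<partial>\<pi>) = integral\<^sup>L \<mu> f - integral\<^sup>L \<nu> f"
      using int\<pi> integral_distr[OF proj(1) f] integral_distr[OF proj(2) f]
      by (simp add: marginals)
    then have "ennreal ?d \<le> (\<integral>\<^sup>+p. norm (f (fst p) - f (snd p)) \<partial>\<pi>)"
      using integral_norm_bound_ennreal[of \<pi> "\<lambda>p. f (fst p) - f (snd p)"] int\<pi> by simp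
    then have "ennreal (?d / K) \<le> (\<integral>\<^sup>+p. norm (f (fst p) - f (snd p)) \<partial>\<pi>) / ennreal K"
      using \<open>K > 0\<close> by (simp add: divide_ennreal[symmetric] divide_right_mono_ennreal)
    also have "\<dots> = (\<integral>\<^sup>+p. norm (f (fst p) - f (snd p)) / ennreal K \<partial>\<pi>)"
      using int\<pi> by (intro nn_integral_divide[symmetric]) (auto dest!: borel_measurable_integrable)
    also have "\<dots> \<le> (\<integral>\<^sup>+p. ennreal (dist (fst p) (snd p)) \<partial>\<pi>)"
      using Lipschitz \<open>K > 0\<close>
      by (intro nn_integral_mono)
        (simp add: divide_ennreal ennreal_leI pos_divide_le_eq mult.commute)
    finally show "ennreal (?d / K) \<le> (\<integral>\<^sup>+p. ennreal (dist (fst p) (snd p)) \<partial>\<pi>)" .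
  qed
  then have "ennreal (?d / K) \<le> ennreal c"
    using W by (rule order_trans)
  then show ?thesis
    using \<open>K > 0\<close> \<open>c \<ge> 0\<close> by (simp add: pos_divide_le_eq mult.commute)
qed

section \<open>The saddle map of a strongly convex-concave function\<close>

locale smooth_saddle_function =
  fixes \<phi> :: "'a::euclidean_space \<times> 'b::euclidean_space \<Rightarrow> 'w::polish_space \<Rightarrow> real"
    and \<gamma> L :: real
  assumes \<gamma>_pos: "\<gamma> > 0" and L_pos: "L > 0"
    and C1: "continuously_differentiable (\<lambda>z. \<phi> z w)"
    and convex: "strongly_convex \<gamma> (\<lambda>x. \<phi> (x, y) w)"
    and concave: "strongly_concave \<gamma> (\<lambda>y. \<phi> (x, y) w)"
    and Lipschitz_z: "norm (saddle_map \<phi> z w - saddle_map \<phi> z' w) \<le> L * norm (z - z')"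
    and Lipschitz_w: "norm (saddle_map \<phi> z w - saddle_map \<phi> z w') \<le> L * dist w w'"
begin

lemma partially_differentiable:
  shows "(\<lambda>x. \<phi> (x, y) w) differentiable (at x)"
    and "(\<lambda>y. \<phi> (x, y) w) differentiable (at y)"
proof -
  obtain \<phi>' where \<phi>': "((\<lambda>z. \<phi> z w) has_derivative \<phi>') (at (x, y))"
    using C1[of w] by (auto simp: continuously_differentiable_def)
  have "((\<lambda>x. (x, y)) has_derivative (\<lambda>h. (h, 0))) (at x)"
    by (auto intro!: derivative_eq_intros)
  from has_derivative_compose[OF this \<phi>'] show "(\<lambda>x. \<phi> (x, y) w) differentiable (at x)"
    by (auto simp: differentiable_def)
  have "((\<lambda>y. (x, y)) has_derivative (\<lambda>h. (0, h))) (at y)"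
    by (auto intro!: derivative_eq_intros)
  from has_derivative_compose[OF this \<phi>'] show "(\<lambda>y. \<phi> (x, y) w) differentiable (at y)"
    by (auto simp: differentiable_def)
qed

text \<open>
  The first-order inequalities for \<open>\<phi>(\<sqdot>, y)\<close> and for \<open>- \<phi>(x, \<sqdot>)\<close> at \<open>z = (x, y)\<close> add up, since the
  value \<open>\<phi> z\<close> cancels and the sign in the second component of the saddle map matches.
\<close>

lemma gap_inequality:
  "saddle_map \<phi> z w \<bullet> (z' - z) + \<gamma> / 2 * (norm (z' - z))\<^sup>2
    \<le> \<phi> (fst z', snd z) w - \<phi> (fst z, snd z') w"
proof -
  obtain x y x' y' where [simp]: "z = (x, y)" "z' = (x', y')"
    by fastforce
  have min_grad: "gradient (\<lambda>y. - \<phi> (x, y) w) y = - gradient (\<lambda>y. \<phi> (x, y) w) y"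
  proof -
    have "GDERIV (\<lambda>y. - \<phi> (x, y) w) y :> - gradient (\<lambda>y. \<phi> (x, y) w) y"
      using GDERIV_gradient[OF partially_differentiable(2)] by (rule GDERIV_minus)
    moreover have "GDERIV (\<lambda>y. - \<phi> (x, y) w) y :> gradient (\<lambda>y. - \<phi> (x, y) w) y"
      using partially_differentiable(2) by (intro GDERIV_gradient) simp
    ultimately have "(\<lambda>h. h \<bullet> gradient (\<lambda>y. - \<phi> (x, y) w) y)
        = (\<lambda>h. h \<bullet> - gradient (\<lambda>y. \<phi> (x, y) w) y)"
      unfolding gderiv_def by (metis has_derivative_unique)
    then show ?thesis
      by (metis vector_eq_ldot)
  qed
  have "\<phi> (x, y) w + gradient (\<lambda>x. \<phi> (x, y) w) x \<bullet> (x' - x) + \<gamma> / 2 * (norm (x' - x))\<^sup>2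
      \<le> \<phi> (x', y) w"
    using strongly_convex_gradient_le[OF convex partially_differentiable(1)] .
  moreover have "- \<phi> (x, y) w + - gradient (\<lambda>y. \<phi> (x, y) w) y \<bullet> (y' - y)
      + \<gamma> / 2 * (norm (y' - y))\<^sup>2 \<le> - \<phi> (x, y') w"
    using strongly_convex_gradient_le[OF concave[unfolded strongly_concave_def], of x w y y']
      partially_differentiable(2) min_grad by simp
  moreover have "(norm (z' - z))\<^sup>2 = (norm (x' - x))\<^sup>2 + (norm (y' - y))\<^sup>2"
    by (simp add: norm_Pair)
  ultimately show ?thesis
    by (simp add: saddle_map_def inner_Pair algebra_simps)
qed

lemma saddle_map_strongly_monotone:
  "\<gamma> * (norm (z - z'))\<^sup>2 \<le> (saddle_map \<phi> z w - saddle_map \<phi> z' w) \<bullet> (z - z')"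
  using gap_inequality[of z w z'] gap_inequality[of z' w z]
  by (simp add: norm_minus_commute inner_diff_left inner_diff_right)

lemma \<gamma>_le_L: "\<gamma> \<le> L"
proof -
  obtain e :: "'a \<times> 'b" where e: "norm e = 1"
    using vector_choose_size[of 1] zero_le_one by metis
  fix w
  have "\<gamma> * (norm (e - 0))\<^sup>2 \<le> (saddle_map \<phi> e w - saddle_map \<phi> 0 w) \<bullet> (e - 0)"
    by (rule saddle_map_strongly_monotone)
  also have "\<dots> \<le> norm (saddle_map \<phi> e w - saddle_map \<phi> 0 w) * norm (e - 0)"
    by (rule norm_cauchy_schwarz)
  also have "\<dots> \<le> L * norm (e - 0) * norm (e - 0)"
    using Lipschitz_z by (rule mult_right_mono) simp
  finally show ?thesis
    by (simp add: e)
qed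

end

section \<open>Decision-dependent games\<close>

locale decision_dependent_game = smooth_saddle_function \<phi> \<gamma> L
  for \<phi> :: "'a::euclidean_space \<times> 'b::euclidean_space \<Rightarrow> 'w::polish_space \<Rightarrow> real" and \<gamma> L +
  fixes D :: "'a \<times> 'b \<Rightarrow> 'w measure" and \<epsilon> :: real and X :: "'a set" and Y :: "'b set"
  assumes \<epsilon>_nonneg: "\<epsilon> \<ge> 0" and \<epsilon>_small: "\<epsilon> * L < \<gamma>"
    and D_range: "D z \<in> radon_prob_moment1"
    and D_Lipschitz: "wasserstein1 (D z) (D z') \<le> ennreal (\<epsilon> * norm (z - z'))"
    and integrable_\<phi>: "z \<in> X \<times> Y \<Longrightarrow> z' \<in> X \<times> Y \<Longrightarrow> integrable (D z') (\<phi> z)"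
    and closed_X: "closed X" and convex_X: "convex X" and X_ne: "X \<noteq> {}"
    and closed_Y: "closed Y" and convex_Y: "convex Y" and Y_ne: "Y \<noteq> {}"
begin

abbreviation \<Psi> :: "'a \<times> 'b \<Rightarrow> 'a \<times> 'b \<Rightarrow> 'a \<times> 'b" where
  "\<Psi> \<equiv> mean_saddle_map \<phi> D"

lemma feasible_set:
  shows "closed (X \<times> Y)" and "convex (X \<times> Y)" and "X \<times> Y \<noteq> {}"
  using closed_X convex_X X_ne closed_Y convex_Y Y_ne by (auto intro: closed_Times convex_Times)

lemma prob_space_D: "prob_space (D z)"
  using D_range by (simp add: radon_prob_moment1_def radon_prob_def)

lemma integrable_saddle_map: "integrable (D z') (saddle_map \<phi> z)"
  using D_range Lipschitz_w by (rule integrable_Lipschitz)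

lemma mean_saddle_map_strongly_monotone:
  "\<gamma> * (norm (z - z'))\<^sup>2 \<le> (\<Psi> z u - \<Psi> z' u) \<bullet> (z - z')"
proof -
  interpret prob_space "D u" by (rule prob_space_D)
  have "\<gamma> * (norm (z - z'))\<^sup>2
      \<le> (LINT w|D u. (saddle_map \<phi> z w - saddle_map \<phi> z' w) \<bullet> (z - z'))"
    using integral_mono[of "D u" "\<lambda>_. \<gamma> * (norm (z - z'))\<^sup>2"
        "\<lambda>w. (saddle_map \<phi> z w - saddle_map \<phi> z' w) \<bullet> (z - z')"]
      integrable_saddle_map saddle_map_strongly_monotone by (simp add: prob_space)
  then show ?thesis
    using integrable_saddle_map by (simp add: mean_saddle_map_def)
qed

lemma mean_saddle_map_Lipschitz: "norm (\<Psi> z u - \<Psi> z' u) \<le> L * norm (z - z')"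
proof -
  interpret prob_space "D u" by (rule prob_space_D)
  have int: "integrable (D u) (\<lambda>w. saddle_map \<phi> z w - saddle_map \<phi> z' w)"
    using integrable_saddle_map by simp
  have "norm (\<Psi> z u - \<Psi> z' u) \<le> (LINT w|D u. norm (saddle_map \<phi> z w - saddle_map \<phi> z' w))"
    using integral_norm_bound[of "D u" "\<lambda>w. saddle_map \<phi> z w - saddle_map \<phi> z' w"]
      integrable_saddle_map by (simp add: mean_saddle_map_def)
  also have "\<dots> \<le> (LINT w|D u. L * norm (z - z'))"
    using int Lipschitz_z by (intro integral_mono) auto
  finally show ?thesis
    by (simp add: prob_space)
qed

lemma mean_saddle_map_Lipschitz_distribution:
  "norm (\<Psi> z u - \<Psi> z u') \<le> \<epsilon> * L * norm (u - u')"
  using norm_integral_diff_le_wasserstein1[OF D_range D_range Lipschitz_w L_pos _ D_Lipschitz]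
    \<epsilon>_nonneg by (simp add: mean_saddle_map_def mult_ac)

lemma ex1_equilibrium_solution: "\<exists>!z. variational_solution (X \<times> Y) (\<lambda>u. \<Psi> u u) z"
  by (rule ex1_variational_solution[where G = \<Psi>, OF feasible_set
        mean_saddle_map_strongly_monotone mean_saddle_map_Lipschitz
        mean_saddle_map_Lipschitz_distribution less_imp_le[OF \<gamma>_pos] \<gamma>_le_L L_pos \<epsilon>_nonneg \<epsilon>_small])

lemma ex_fixed_distribution_solution: "\<exists>z. variational_solution (X \<times> Y) (\<lambda>u. \<Psi> u z') z"
proof -
  have "\<exists>!z. variational_solution (X \<times> Y) (\<lambda>u. (\<lambda>v _. \<Psi> v z') u u) z"
    by (rule ex1_variational_solution[where \<gamma> = \<gamma> and L = L and \<epsilon> = 0, OF feasible_set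
          mean_saddle_map_strongly_monotone mean_saddle_map_Lipschitz])
      (use \<gamma>_pos \<gamma>_le_L L_pos in auto)
  then show ?thesis
    by (rule ex1_implies_ex)
qed

lemma mean_gap_inequality:
  assumes "z \<in> X \<times> Y" "z' \<in> X \<times> Y" "u \<in> X \<times> Y"
  shows "\<Psi> z u \<bullet> (z' - z) + \<gamma> / 2 * (norm (z' - z))\<^sup>2
    \<le> (LINT w|D u. \<phi> (fst z', snd z) w) - (LINT w|D u. \<phi> (fst z, snd z') w)"
proof -
  interpret prob_space "D u" by (rule prob_space_D)
  have int: "integrable (D u) (\<phi> (fst z', snd z))" "integrable (D u) (\<phi> (fst z, snd z'))"
    using assms by (auto intro!: integrable_\<phi>)
  have "(LINT w|D u. saddle_map \<phi> z w \<bullet> (z' - z) + \<gamma> / 2 * (norm (z' - z))\<^sup>2)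
      \<le> (LINT w|D u. \<phi> (fst z', snd z) w - \<phi> (fst z, snd z') w)"
    using int integrable_saddle_map gap_inequality by (intro integral_mono) auto
  then show ?thesis
    using int integrable_saddle_map by (simp add: mean_saddle_map_def prob_space)
qed

text \<open>
  Moving only one of the two components of a solution \<open>z\<close> in the mean gap inequality shows that
  the solution is a saddle point with quadratic growth. Hence the inner supremum at \<open>fst z\<close> and the
  inner infimum at \<open>snd z\<close> are both the saddle value, and \<open>z\<close> satisfies both optimality conditions.
  Conversely, a minimiser \<open>x\<close> of the inner supremum has payoff at most the saddle value against
  \<open>snd z\<close>, so quadratic growth forces \<open>x = fst z\<close>; symmetrically for the maximiser.
\<close>

lemma best_responses_iff_eq_variational_solution:
  assumes sol: "variational_solution (X \<times> Y) (\<lambda>v. \<Psi> v u) z" and u: "u \<in> X \<times> Y"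
  shows "is_arg_min (\<lambda>x. SUP y\<in>Y. ereal (LINT w|D u. \<phi> (x, y) w)) (\<lambda>x. x \<in> X) a \<and>
      is_arg_max (\<lambda>y. INF x\<in>X. ereal (LINT w|D u. \<phi> (x, y) w)) (\<lambda>y. y \<in> Y) b \<longleftrightarrow> (a, b) = z"
proof -
  obtain x y where z: "z = (x, y)"
    by fastforce
  have xy: "x \<in> X" "y \<in> Y"
    using sol by (auto simp: variational_solution_def z)
  define F where "F p q = (LINT w|D u. \<phi> (p, q) w)" for p q
  have gap: "\<gamma> / 2 * (norm ((p, q) - z))\<^sup>2 \<le> F p y - F x q" if "p \<in> X" "q \<in> Y" for p q
    using mean_gap_inequality[of z "(p, q)" u] sol u that xy
    by (fastforce simp: variational_solution_def F_def z)
  have growth_x: "F x y + \<gamma> / 2 * (norm (p - x))\<^sup>2 \<le> F p y" if "p \<in> X" for p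
    using gap[OF that xy(2)] by (simp add: z norm_Pair)
  have growth_y: "F x q + \<gamma> / 2 * (norm (q - y))\<^sup>2 \<le> F x y" if "q \<in> Y" for q
    using gap[OF xy(1) that] by (simp add: z norm_Pair)
  have min_x: "F x y \<le> F p y" if "p \<in> X" for p
    using growth_x[OF that] \<gamma>_pos by (smt (verit) zero_le_power2 mult_nonneg_nonneg half_gt_zero)
  have max_y: "F x q \<le> F x y" if "q \<in> Y" for q
    using growth_y[OF that] \<gamma>_pos by (smt (verit) zero_le_power2 mult_nonneg_nonneg half_gt_zero)
  have sup_x: "(SUP q\<in>Y. ereal (F x q)) = ereal (F x y)"
    using max_y xy by (intro antisym SUP_least SUP_upper) auto
  have inf_y: "(INF p\<in>X. ereal (F p y)) = ereal (F x y)"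
    using min_x xy by (intro antisym INF_greatest INF_lower) auto
  have sup_ge: "ereal (F p y) \<le> (SUP q\<in>Y. ereal (F p q))" for p
    using xy by (intro SUP_upper)
  have inf_le: "(INF p\<in>X. ereal (F p q)) \<le> ereal (F x q)" for q
    using xy by (intro INF_lower)
  have "is_arg_min (\<lambda>p. SUP q\<in>Y. ereal (F p q)) (\<lambda>p. p \<in> X) a \<longleftrightarrow> a = x"
  proof
    assume "is_arg_min (\<lambda>p. SUP q\<in>Y. ereal (F p q)) (\<lambda>p. p \<in> X) a"
    then have a: "a \<in> X" "(SUP q\<in>Y. ereal (F a q)) \<le> (SUP q\<in>Y. ereal (F x q))"
      using xy by (auto simp: is_arg_min_linorder)
    then have "F a y \<le> F x y"
      using order_trans[OF sup_ge a(2)] by (simp add: sup_x)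
    then have "\<gamma> / 2 * (norm (a - x))\<^sup>2 \<le> 0"
      using growth_x[OF a(1)] by simp
    then show "a = x"
      using \<gamma>_pos by (simp add: mult_le_0_iff)
  next
    assume "a = x"
    then show "is_arg_min (\<lambda>p. SUP q\<in>Y. ereal (F p q)) (\<lambda>p. p \<in> X) a"
      using xy min_x order_trans[OF _ sup_ge] by (auto simp: is_arg_min_linorder sup_x)
  qed
  moreover have "is_arg_max (\<lambda>q. INF p\<in>X. ereal (F p q)) (\<lambda>q. q \<in> Y) b \<longleftrightarrow> b = y"
  proof
    assume "is_arg_max (\<lambda>q. INF p\<in>X. ereal (F p q)) (\<lambda>q. q \<in> Y) b"
    then have b: "b \<in> Y" "(INF p\<in>X. ereal (F p y)) \<le> (INF p\<in>X. ereal (F p b))"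
      using xy by (auto simp: is_arg_max_linorder)
    then have "F x y \<le> F x b"
      using order_trans[OF b(2) inf_le] by (simp add: inf_y)
    then have "\<gamma> / 2 * (norm (b - y))\<^sup>2 \<le> 0"
      using growth_y[OF b(1)] by simp
    then show "b = y"
      using \<gamma>_pos by (simp add: mult_le_0_iff)
  next
    assume "b = y"
    then show "is_arg_max (\<lambda>q. INF p\<in>X. ereal (F p q)) (\<lambda>q. q \<in> Y) b"
      using xy max_y order_trans[OF inf_le] by (auto simp: is_arg_max_linorder inf_y)
  qed
  ultimately show ?thesis
    by (simp add: z F_def)
qed

lemma equilibrium_point_iff_variational_solution:
  "equilibrium_point \<phi> D X Y z \<longleftrightarrow> variational_solution (X \<times> Y) (\<lambda>u. \<Psi> u u) z"
proof (cases "z \<in> X \<times> Y")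
  case True
  obtain s where s: "variational_solution (X \<times> Y) (\<lambda>v. \<Psi> v z) s"
    using ex_fixed_distribution_solution by blast
  have "equilibrium_point \<phi> D X Y z \<longleftrightarrow> z = s"
    using best_responses_iff_eq_variational_solution[OF s True, of "fst z" "snd z"]
    by (simp add: equilibrium_point_def)
  moreover have "variational_solution (X \<times> Y) (\<lambda>v. \<Psi> v z) z \<Longrightarrow> equilibrium_point \<phi> D X Y z"
    using best_responses_iff_eq_variational_solution[of z z, OF _ True, of "fst z" "snd z"]
    by (simp add: equilibrium_point_def)
  ultimately show ?thesis
    using s by (auto simp: variational_solution_def)
next
  case False
  then show ?thesis
    by (cases z) (auto simp: equilibrium_point_def variational_solution_def is_arg_min_def
        is_arg_max_def)
qed

lemma projected_gradient_seq_step_le: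
  assumes zbar: "equilibrium_point \<phi> D X Y zbar" and "\<eta> > 0"
    and seq: "projected_gradient_seq \<phi> D X Y \<eta> z"
  shows "dist (z (Suc t)) zbar
    \<le> (sqrt (1 - 2 * \<eta> * \<gamma> + \<eta>\<^sup>2 * L\<^sup>2) + \<eta> * \<epsilon> * L) * dist (z t) zbar"
proof -
  let ?P = "projected_step (X \<times> Y) \<eta> (\<lambda>u. \<Psi> u u)"
  have "?P zbar = zbar"
    using zbar projected_step_fixed_iff[OF feasible_set \<open>\<eta> > 0\<close>]
    by (simp add: equilibrium_point_iff_variational_solution)
  moreover have "z (Suc t) = ?P (z t)"
    using seq by (simp add: projected_gradient_seq_def projected_step_def)
  ultimately show ?thesis
    using projected_step_Lipschitz[where G = \<Psi>, OF feasible_set mean_saddle_map_strongly_monotone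
        mean_saddle_map_Lipschitz mean_saddle_map_Lipschitz_distribution \<open>\<eta> > 0\<close>, of "z t" zbar]
    by (simp add: mult.assoc)
qed

end

section \<open>Linear convergence of the projected gradient method\<close>

lemma geometric_bound:
  fixes s :: "nat \<Rightarrow> 'a::metric_space"
  assumes "0 \<le> \<alpha>" "\<And>t. dist (s (Suc t)) l \<le> \<alpha> * dist (s t) l"
  shows "dist (s t) l \<le> \<alpha> ^ t * dist (s 0) l"
proof (induction t)
  case (Suc t)
  then show ?case
    using order_trans[OF assms(2)[of t] mult_left_mono[OF Suc assms(1)]] by (simp add: mult_ac)
qed simp

lemma converges_linearlyI:
  assumes "0 \<le> \<alpha>" "\<alpha> < 1" "\<And>t. dist (s (Suc t)) l \<le> \<alpha> * dist (s t) l"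
  shows "converges_linearly s l"
proof -
  have "(\<lambda>t. \<alpha> ^ t * dist (s 0) l) \<longlonglongrightarrow> 0 * dist (s 0) l"
    using assms(1,2) by (intro tendsto_mult tendsto_const LIMSEQ_realpow_zero)
  then have "(\<lambda>t. dist (s t) l) \<longlonglongrightarrow> 0"
    using geometric_bound[of \<alpha> s l, OF assms(1,3)]
    by (intro tendsto_sandwich[of "\<lambda>_. 0" "\<lambda>t. dist (s t) l" sequentially
          "\<lambda>t. \<alpha> ^ t * dist (s 0) l"]) auto
  then have "s \<longlonglongrightarrow> l"
    by (rule tendsto_dist_iff[THEN iffD2])
  then show ?thesis
    using assms unfolding converges_linearly_def by blast
qed

theorem theorem2p9:
  fixes \<phi> :: "(real ^ 'n) \<times> (real ^ 'm) \<Rightarrow> 'w::polish_space \<Rightarrow> real"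
    and D :: "(real ^ 'n) \<times> (real ^ 'm) \<Rightarrow> 'w measure"
    and X :: "(real ^ 'n) set" and Y :: "(real ^ 'm) set"
    and \<gamma> L \<epsilon> \<eta> \<alpha> :: real
  assumes "\<gamma> > 0" and "L > 0" and "\<epsilon> \<ge> 0" and "\<epsilon> * L / \<gamma> < 1"
    and D_range: "\<And>z. D z \<in> radon_prob_moment1"
    and phi_integrable:
      "\<And>z z'. z \<in> X \<times> Y \<Longrightarrow> z' \<in> X \<times> Y \<Longrightarrow> integrable (D z') (\<phi> z)"
    and phi_C1: "\<And>w. continuously_differentiable (\<lambda>z. \<phi> z w)"
    and phi_convex: "\<And>w y. strongly_convex \<gamma> (\<lambda>x. \<phi> (x, y) w)"
    and phi_concave: "\<And>w x. strongly_concave \<gamma> (\<lambda>y. \<phi> (x, y) w)"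
    and psi_Lipschitz_z:
      "\<And>z z' w. norm (saddle_map \<phi> z w - saddle_map \<phi> z' w) \<le> L * norm (z - z')"
    and psi_Lipschitz_w:
      "\<And>z w w'. norm (saddle_map \<phi> z w - saddle_map \<phi> z w') \<le> L * dist w w'"
    and D_Lipschitz: "\<And>z z'. wasserstein1 (D z) (D z') \<le> ennreal (\<epsilon> * norm (z - z'))"
    and "compact X" and "convex X" and "X \<noteq> {}"
    and "compact Y" and "convex Y" and "Y \<noteq> {}"
    and "\<eta> > 0"
    and alpha: "\<alpha> = sqrt (1 - 2 * \<eta> * \<gamma> + \<eta>\<^sup>2 * L\<^sup>2) + \<eta> * \<epsilon> * L"
  shows "(\<exists>!zbar. equilibrium_point \<phi> D X Y zbar) \<and>
    (\<forall>zbar. equilibrium_point \<phi> D X Y zbar \<longrightarrow>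
      (\<forall>z. projected_gradient_seq \<phi> D X Y \<eta> z \<longrightarrow>
        (\<forall>t. norm (z t - zbar) \<le> \<alpha> ^ t * norm (z 0 - zbar)) \<and>
        (\<eta> \<in> {0<..<2 * (\<gamma> - \<epsilon> * L) / (L\<^sup>2 * (1 - \<epsilon>\<^sup>2))} \<longrightarrow>
          converges_linearly z zbar)))"
proof -
  have small: "\<epsilon> * L < \<gamma>"
    using \<open>\<epsilon> * L / \<gamma> < 1\<close> \<open>\<gamma> > 0\<close> by (simp add: pos_divide_less_eq)
  interpret decision_dependent_game \<phi> \<gamma> L D \<epsilon> X Y
    by unfold_locales (use assms small in \<open>auto intro: compact_imp_closed\<close>)
  have "\<exists>!zbar. equilibrium_point \<phi> D X Y zbar"
    using ex1_equilibrium_solution by (simp add: equilibrium_point_iff_variational_solution)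
  moreover have "(\<forall>t. norm (z t - zbar) \<le> \<alpha> ^ t * norm (z 0 - zbar)) \<and>
      (\<eta> \<in> {0<..<2 * (\<gamma> - \<epsilon> * L) / (L\<^sup>2 * (1 - \<epsilon>\<^sup>2))} \<longrightarrow> converges_linearly z zbar)"
    if "equilibrium_point \<phi> D X Y zbar" "projected_gradient_seq \<phi> D X Y \<eta> z" for zbar z
  proof -
    have step: "dist (z (Suc t)) zbar \<le> \<alpha> * dist (z t) zbar" for t
      unfolding alpha using that(1) \<open>\<eta> > 0\<close> that(2) by (rule projected_gradient_seq_step_le)
    have nonneg: "0 \<le> \<alpha>"
      unfolding alpha using \<gamma>_pos \<gamma>_le_L \<epsilon>_nonneg \<open>\<eta> > 0\<close>
      by (intro contraction_factor_nonneg) auto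
    have "\<alpha> < 1" if "\<eta> \<in> {0<..<2 * (\<gamma> - \<epsilon> * L) / (L\<^sup>2 * (1 - \<epsilon>\<^sup>2))}"
      unfolding alpha using \<gamma>_le_L L_pos \<epsilon>_nonneg small that
      by (intro contraction_factor_less_1) auto
    then show ?thesis
      using geometric_bound[of \<alpha> z zbar, OF nonneg step]
        converges_linearlyI[of \<alpha> z zbar, OF nonneg _ step]
      by (auto simp: dist_norm)
  qed
  ultimately show ?thesis
    by blast
qed

end
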